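(* Let $\sigma_s>0$, a symmetric matrix $\Lambda$, weights $r_1,r_2$, and offline data $(\hat U,\hat X,\hat W)$ be given, and consider the moving horizon closed loop described in the context, i.e. the true system with $u(t)=K_tx(t)$, $K_t=L_tQ_t^{-1}$, $t\ge 0$. Suppose that (a) the disturbance assumption (Assumption 1 of the context) holds; (b) the offline data $(\hat U,\hat X,\hat W)$ generated by the true system are admissible; (c) the optimization problem $\mathcal P_t$ of the context is feasible with a solution $(\lambda_t,\beta_t,\sigma_t,\gamma_t,Q_t,L_t)$ at every time $t\ge 0$; (d) the set of optimal solutions $(\lambda_t,\beta_t,\sigma_t,\gamma_t,Q_t,L_t)$, $t\ge 0$, is bounded. Then the closed-loop system has the following properties: (i) the time-domain constraint $|y_{2m}(t)|\le y_{2m,\max}$, $m=1,\dots,q_2$, is satisfied at every time $t\ge 0$; (ii) the system is stabilized for finite-energy disturbances: $x(t)\to 0$ as $t\to\infty$ whenever $\sum_{t=0}^\infty\|w(t)\|^2<\infty$; (iii) the $H_\infty$ norm from $w$ to $y_1$ is bounded above by $\gamma_\infty:=\lim_{t\to\infty}\max\{\gamma_0,\dots,\gamma_t\}<\infty$, i.e. for $x(0)=0$ and finite-energy $w$, $\sum_{i=0}^\infty\|y_1(i)\|^2\le\gamma_\infty^2\sum_{i=0}^\infty\|w(i)\|^2$; (iv) the closed-loop system exhibits disturbance attenuation: with some $\gamma<\infty$, for all $t\ge t_0\ge 0$, $$\sum_{i=t_0}^t\big(\|y_1(i)\|^2-\gamma^2\|w(i)\|^2\big)\le x(t_0)^TP_{t_0}x(t_0)+p_0-p_{t_0},\qquad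 p_0-p_{t_0}\ge 0.$$
   Context: **System.** The true discrete-time linear time-invariant system is $$x(t+1)=A_\nu x(t)+B_\nu u(t)+E_\nu w(t),\quad y_1(t)=C_1x(t)+D_1u(t)+E_1w(t),\quad y_2(t)=C_2x(t)+D_2u(t),$$ with $x\in\mathbb R^p$, $u\in\mathbb R^q$, $w\in\mathbb R^l$, $y_1\in\mathbb R^{q_1}$, $y_2\in\mathbb R^{q_2}$. The matrices $A_\nu,B_\nu,E_\nu$ are unknown; $C_1,C_2,D_1,D_2,E_1$ are known. Standing assumptions: $(A_\nu,B_\nu)$ is stabilizable and $(C_1,A_\nu)$ is observable. The time-domain constraint is $|y_{2m}(t)|\le y_{2m,\max}$ for all $t\ge0$, $m=1,\dots,q_2$, with given bounds. **Data.** $\hat X=[x(0)\ \cdots\ x(T)]$, $\hat U=[u(0)\ \cdots\ u(T-1)]$, $\hat W=[w(0)\ \cdots\ w(T-1)]$, $\hat X_-=[x(0)\ \cdots\ x(T-1)]$, $\hat X_+=[x(1)\ \cdots\ x(T)]$ are sampled from the true system, so $\hat X_+=A_\nu\hat X_-+B_\nu\hat U+E_\nu\hat W$; this is the sense in which the data are admissible. **Assumption 1.** The disturbance samples satisfy $\sum_{t=0}^{T-1}\|w(t)\|^2\le\alpha$, with $\|w(t)\|^2\le\alpha_t$ for given scalars $\alpha_t\ge0$; the disturbance is energy-bounded, i.e. as $T\to\infty$, $w\in L_2[0,\infty)$ (square summable with overall bound $\alpha\ge 0$). **LMIs.** Variables are $\sigma,\lambda,\beta,\gamma^2\in\mathbb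 R$, $Q=Q^T>0$ in $\mathbb R^{p\times p}$, $L\in\mathbb R^{q\times p}$; $C_L:=C_1Q+D_1L$; $\ast$ denotes symmetric entries. (A1) With $D:=[\hat X_+^T\ \ -\hat X_-^T\ \ -\hat U^T\ \ -\hat W^T\ \ 0\ \ 0\ \ 0]^T$ (block row sizes $p,p,q,l,p,l,q_1$), $$\begin{bmatrix}Q-\beta I&0&0&0&0&0&0\\ \ast&0&0&0&Q&0&0\\ \ast&\ast&0&0&L&0&0\\ \ast&\ast&\ast&0&0&I&0\\ \ast&\ast&\ast&\ast&Q&-C_L^TE_1&C_L^T\\ \ast&\ast&\ast&\ast&\ast&\gamma^2I-E_1^TE_1&0\\ \ast&\ast&\ast&\ast&\ast&\ast&I\end{bmatrix}+\lambda DD^T\ge0.$$ (A2) $\begin{bmatrix}Q&-C_L^TE_1&C_L^T\\ \ast&\gamma^2I-E_1^TE_1&0\\ \ast&\ast&I\end{bmatrix}>0.$ (B) $\begin{bmatrix}\frac1{\sigma_s}\Lambda&C_2Q+D_2L\\ (C_2Q+D_2L)^T&Q\end{bmatrix}\ge0$ and $\Lambda_{ii}\le y_{2i,\max}^2$, $i=1,\dots,q_2$. (C$_t$) $\begin{bmatrix}\sigma&x(t)^T\\ x(t)&Q\end{bmatrix}\ge0.$ (D$_t$) (for $t>0$) $\begin{bmatrix}x(t)^TP_{t-1}x(t)+p_0-p_{t-1}&x(t)^T\\ x(t)&Q\end{bmatrix}\ge0.$ **Problem $\mathcal P_t$.** At time $t$, with current state $x(t)$: minimize $r_1\sigma+r_2\gamma^2$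 over $\sigma,\lambda,\beta,\gamma^2,L,Q$ subject to (A1), (A2), (B), (C$_t$), (D$_t$) and $\sigma\le\sigma_s(1+\eta)$, where $\eta\ge0$ is a scalar that may be increased to obtain feasibility; at $t=0$ the constraint (D$_t$) is omitted. **Moving horizon closed loop.** At each $t\ge0$, solve $\mathcal P_t$ to get an optimal solution $(\sigma_t,\lambda_t,\beta_t,\gamma_t,Q_t,L_t)$, set $P_t=Q_t^{-1}$, $K_t=L_tQ_t^{-1}$, $p_0=x(0)^TP_0x(0)$ and, for $t>0$, $p_t=p_{t-1}-[x(t)^TP_{t-1}x(t)-x(t)^TP_tx(t)]$; apply $u(t)=K_tx(t)$ to the true system and move to $t+1$.
   Formalization: The constraint β≥0 is added to the problem P_t, since with β<0 the state need not converge; (i) is proved only at times with σ_t≤σ_s (automatic when η=0), since it can fail for η>0; the bounds y_{2m,max} are taken nonnegative. *)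

theory Defs
  imports "HOL-Analysis.Analysis"
begin

definition hcat :: "real^('a::finite)^'m \<Rightarrow> real^('b::finite)^'m \<Rightarrow> real^('a + 'b)^'m"  (infixr "|||" 62)
  where "M ||| N = (\<chi> i j. case j of Inl a \<Rightarrow> M $ i $ a | Inr b \<Rightarrow> N $ i $ b)"

definition vcat :: "real^'n^('a::finite) \<Rightarrow> real^'n^('b::finite) \<Rightarrow> real^'n^('a + 'b)"  (infixr "\<Zsemi>" 61)
  where "M \<Zsemi> N = (\<chi> i. case i of Inl a \<Rightarrow> M $ a | Inr b \<Rightarrow> N $ b)"

definition pos_semidef :: "real^'n^'n \<Rightarrow> bool"
  where "pos_semidef M \<longleftrightarrow> transpose M = M \<and> (\<forall>v. 0 \<le> v \<bullet> (M *v v))"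

definition pos_def :: "real^'n^'n \<Rightarrow> bool"
  where "pos_def M \<longleftrightarrow> transpose M = M \<and> (\<forall>v. v \<noteq> 0 \<longrightarrow> 0 < v \<bullet> (M *v v))"

definition schur_stable :: "real^'n^'n \<Rightarrow> bool"
  where "schur_stable M \<longleftrightarrow>
    (\<forall>(z::complex) v. v \<noteq> 0 \<and> map_matrix complex_of_real M *v v = z *s v \<longrightarrow> cmod z < 1)"

definition stabilizable :: "real^'p^'p \<Rightarrow> real^'q^'p \<Rightarrow> bool"
  where "stabilizable A B \<longleftrightarrow> (\<exists>K. schur_stable (A + B ** K))"

definition observable :: "real^'p^'r \<Rightarrow> real^'p^'p \<Rightarrow> bool"
  where "observable C A \<longleftrightarrow>
    (\<forall>x x'. (\<forall>k. C *v (((*v) A ^^ k) x) = C *v (((*v) A ^^ k) x')) \<longrightarrow> x = x')"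

text \<open>The columns of a data matrix are indexed by a finite linear order \<open>'T\<close>, whose
  cardinality is the number of samples; \<open>col_time j\<close> is the sampling time of column \<open>j\<close>, so that
  \<open>samples s\<close> is the matrix \<open>[s(0) ... s(T-1)]\<close>.\<close>

definition col_time :: "'T::{finite,linorder} \<Rightarrow> nat"
  where "col_time j = card {..<j}"

definition samples :: "(nat \<Rightarrow> real^'n) \<Rightarrow> real^('T::{finite,linorder})^'n"
  where "samples s = (\<chi> i j. s (col_time j) $ i)"

type_synonym ('p, 'q, 'l, 'q1) blocks = "'p + 'p + 'q + 'l + 'p + 'l + 'q1"

definition data_matrix ::
    "real^('T::finite)^('p::finite) \<Rightarrow> real^'T^'p \<Rightarrow> real^'T^('q::finite) \<Rightarrow> real^'T^('l::finite)
      \<Rightarrow> real^'T^('p, 'q, 'l, 'q1::finite) blocks"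
  where "data_matrix Xplus Xminus U W =
    (Xplus \<Zsemi> - Xminus \<Zsemi> - U \<Zsemi> - W \<Zsemi> 0 \<Zsemi> 0 \<Zsemi> 0)"

text \<open>In the matrix inequalities below \<open>g2\<close> stands for the decision variable \<open>\<gamma>\<^sup>2\<close>.\<close>

definition lmi_data ::
    "real^('p::finite)^('q1::finite) \<Rightarrow> real^('q::finite)^'q1 \<Rightarrow> real^('l::finite)^'q1
      \<Rightarrow> real^('T::finite)^('p, 'q, 'l, 'q1) blocks
      \<Rightarrow> real \<Rightarrow> real \<Rightarrow> real \<Rightarrow> real^'p^'p \<Rightarrow> real^'p^'q
      \<Rightarrow> real^('p, 'q, 'l, 'q1) blocks^('p, 'q, 'l, 'q1) blocks"
  where "lmi_data C1 D1 E1 D lam bet g2 Q L =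
    (let CL = C1 ** Q + D1 ** L in
      ( Q - mat bet ||| 0           ||| 0           ||| 0     ||| 0                      ||| 0                           ||| 0
      \<Zsemi> 0           ||| 0           ||| 0           ||| 0     ||| Q                      ||| 0                           ||| 0
      \<Zsemi> 0           ||| 0           ||| 0           ||| 0     ||| L                      ||| 0                           ||| 0
      \<Zsemi> 0           ||| 0           ||| 0           ||| 0     ||| 0                      ||| mat 1                       ||| 0
      \<Zsemi> 0           ||| transpose Q ||| transpose L ||| 0     ||| Q                      ||| - (transpose CL ** E1)      ||| transpose CL
      \<Zsemi> 0           ||| 0           ||| 0           ||| mat 1 ||| - (transpose E1 ** CL) ||| mat g2 - transpose E1 ** E1 ||| 0
      \<Zsemi> 0           ||| 0           ||| 0           ||| 0     ||| CL                     ||| 0                           ||| mat 1)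
      + lam *\<^sub>R (D ** transpose D))"

definition lmi_perf ::
    "real^('p::finite)^('q1::finite) \<Rightarrow> real^('q::finite)^'q1 \<Rightarrow> real^('l::finite)^'q1
      \<Rightarrow> real \<Rightarrow> real^'p^'p \<Rightarrow> real^'p^'q \<Rightarrow> real^('p + 'l + 'q1)^('p + 'l + 'q1)"
  where "lmi_perf C1 D1 E1 g2 Q L =
    (let CL = C1 ** Q + D1 ** L in
       (Q                       ||| - (transpose CL ** E1)     ||| transpose CL)
     \<Zsemi> (- (transpose E1 ** CL) ||| mat g2 - transpose E1 ** E1 ||| 0)
     \<Zsemi> (CL                      ||| 0                          ||| mat 1))"

definition lmi_output ::
    "real^('p::finite)^('q2::finite) \<Rightarrow> real^('q::finite)^'q2 \<Rightarrow> real \<Rightarrow> real^'q2^'q2 \<Rightarrow> real^'p^'p \<Rightarrow> real^'p^'q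
      \<Rightarrow> real^('q2 + 'p)^('q2 + 'p)"
  where "lmi_output C2 D2 sigma_s Lam Q L =
       ((1 / sigma_s) *\<^sub>R Lam             ||| C2 ** Q + D2 ** L)
     \<Zsemi> (transpose (C2 ** Q + D2 ** L) ||| Q)"

text \<open>The state constraint (\<open>s = \<sigma>\<close>) and the dissipation constraint share this form; by a
  Schur complement it says \<open>x\<^sup>T Q\<^sup>-\<^sup>1 x \<le> s\<close>.\<close>

definition lmi_ellipsoid :: "real \<Rightarrow> real^('p::finite) \<Rightarrow> real^'p^'p \<Rightarrow> real^(1 + 'p)^(1 + 'p)"
  where "lmi_ellipsoid s x Q =
       (mat s          ||| rowvector x)
     \<Zsemi> (columnvector x ||| Q)"

primrec dissip_level :: "(nat \<Rightarrow> real^'p) \<Rightarrow> (nat \<Rightarrow> real^'p^'p) \<Rightarrow> nat \<Rightarrow> real"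
  where
    "dissip_level x P 0 = x 0 \<bullet> (P 0 *v x 0)"
  | "dissip_level x P (Suc t) = dissip_level x P t
       - (x (Suc t) \<bullet> (P t *v x (Suc t)) - x (Suc t) \<bullet> (P (Suc t) *v x (Suc t)))"

text \<open>Constraints of the problem at time \<open>t\<close>. The decision variables are
  \<open>(\<sigma>, \<lambda>, \<beta>, \<gamma>\<^sup>2, Q, L)\<close>; of the sequence \<open>P\<close> only the
  entries before \<open>t\<close>, which are known at time \<open>t\<close>, are used. The margin \<open>\<beta>\<close>
  is required to be nonnegative: for negative \<open>\<beta>\<close> the matrix inequality \<open>lmi_data\<close>
  does not imply dissipativity.\<close>

definition mpc_constraints ::
    "real^('p::finite)^('q1::finite) \<Rightarrow> real^('q::finite)^'q1 \<Rightarrow> real^('l::finite)^'q1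
      \<Rightarrow> real^'p^('q2::finite) \<Rightarrow> real^'q^'q2 \<Rightarrow> real^'q2 \<Rightarrow> real \<Rightarrow> real^'q2^'q2
      \<Rightarrow> real^('T::finite)^('p, 'q, 'l, 'q1) blocks
      \<Rightarrow> real \<Rightarrow> (nat \<Rightarrow> real^'p) \<Rightarrow> (nat \<Rightarrow> real^'p^'p) \<Rightarrow> nat
      \<Rightarrow> real \<times> real \<times> real \<times> real \<times> (real^'p^'p) \<times> (real^'p^'q) \<Rightarrow> bool"
  where "mpc_constraints C1 D1 E1 C2 D2 ymax sigma_s Lam D eta x P t =
    (\<lambda>(sigma, lam, bet, g2, Q, L).
       0 \<le> bet \<and> pos_def Q
     \<and> pos_semidef (lmi_data C1 D1 E1 D lam bet g2 Q L)
     \<and> pos_def (lmi_perf C1 D1 E1 g2 Q L)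
     \<and> pos_semidef (lmi_output C2 D2 sigma_s Lam Q L) \<and> (\<forall>i. Lam $ i $ i \<le> (ymax $ i)\<^sup>2)
     \<and> pos_semidef (lmi_ellipsoid sigma (x t) Q)
     \<and> (0 < t \<longrightarrow> pos_semidef (lmi_ellipsoid
           (x t \<bullet> (P (t - 1) *v x t) + dissip_level x P 0 - dissip_level x P (t - 1)) (x t) Q))
     \<and> sigma \<le> sigma_s * (1 + eta))"

definition mpc_cost ::
    "real \<Rightarrow> real \<Rightarrow> real \<times> real \<times> real \<times> real \<times> (real^'p^'p) \<times> (real^'p^'q) \<Rightarrow> real"
  where "mpc_cost r1 r2 = (\<lambda>(sigma, lam, bet, g2, Q, L). r1 * sigma + r2 * g2)"

end

theory Submission
  imports Defs
begin

text \<open>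
  The closed loop is analysed through the storage functions \<open>V\<^sub>t z = z \<bullet> (P t *v z)\<close>, one for each
  solution of the optimization problem.

  The data equation \<open>X\<^sub>+ = A X\<^sub>- + B U + E W\<close> says that the vectors whose first four blocks are
  \<open>(a, A\<^sup>T a, B\<^sup>T a, E\<^sup>T a)\<close> are annihilated by the transposed data matrix, so that on them the term
  with \<open>\<lambda>\<close> disappears and the data inequality becomes a statement about the unknown true system.
  For \<open>a = - P\<^sub>t x(t+1)\<close> and suitable remaining blocks it is the dissipation inequality
  \<open>\<parallel>y\<^sub>1\<parallel>\<^sup>2 - \<gamma>\<^sub>t\<^sup>2 \<parallel>w\<parallel>\<^sup>2 \<le> V\<^sub>t (x(t)) - V\<^sub>t (x(t+1))\<close>.

  That alone does not make the state converge: the output may vanish along the closed loop although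
  the state does not. The missing decrease is hidden in the same inequality.
  Its second diagonal block is zero without the \<open>\<lambda>\<close> term, while the entry \<open>Q\<close> couples that block to
  the state. Perturbing the second block of the test vector by \<open>- x / k\<close> gains \<open>2 \<parallel>x\<parallel>\<^sup>2 / k\<close> at a cost
  \<open>\<lambda> \<parallel>X\<^sub>-\<^sup>T x\<parallel>\<^sup>2 / k\<^sup>2\<close>, which is at most \<open>\<parallel>x\<parallel>\<^sup>2 / k\<close> for large \<open>k\<close>. This adds \<open>\<parallel>x(t)\<parallel>\<^sup>2 / k\<close> to the
  left side of the dissipation inequality (\<open>lmi_data_dissipation\<close>). Boundedness of the multipliers
  \<open>\<lambda>\<^sub>t\<close> makes one \<open>k\<close> work at all times.

  Summing over time leaves the jumps \<open>V\<^sub>t (x(t)) - V\<^bsub>t-1\<^esub> (x(t))\<close>, which are the increments of the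
  dissipation level \<open>p\<^sub>t\<close> (\<open>sum_supply_le_dissip_level\<close>); the dissipation constraint is the bound
  \<open>p\<^sub>t \<le> p\<^sub>0\<close>. Hence the energy of the output and of the state is finite, which gives convergence of
  the state, the \<open>H\<^sub>\<infinity>\<close> bound and disturbance attenuation. The output constraint is a pointwise
  consequence of the Schur complements \<open>lmi_ellipsoid_imp\<close> and \<open>lmi_output_imp\<close>.
\<close>

section \<open>Block vectors and quadratic forms\<close>

definition block_vec :: "real^('a::finite) \<Rightarrow> real^('b::finite) \<Rightarrow> real^('a + 'b)"  (infixr "\<oplus>\<oplus>" 66)
  where "x \<oplus>\<oplus> y = (\<chi> i. case i of Inl a \<Rightarrow> x $ a | Inr b \<Rightarrow> y $ b)"

lemma sum_UNIV_Plus: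
  fixes f :: "'a::finite + 'b::finite \<Rightarrow> 'c::comm_monoid_add"
  shows "sum f UNIV = (\<Sum>a\<in>UNIV. f (Inl a)) + (\<Sum>b\<in>UNIV. f (Inr b))"
  by (simp add: UNIV_Plus_UNIV [symmetric] sum.Plus comp_def del: UNIV_Plus_UNIV)

lemma inner_block_vec [simp]: "(x \<oplus>\<oplus> y) \<bullet> (x' \<oplus>\<oplus> y') = x \<bullet> x' + y \<bullet> y'"
  by (simp add: inner_vec_def block_vec_def sum_UNIV_Plus)

lemma hcat_mult_block_vec [simp]: "(M ||| N) *v (x \<oplus>\<oplus> y) = M *v x + N *v y"
  by (simp add: vec_eq_iff matrix_vector_mult_def hcat_def block_vec_def sum_UNIV_Plus)

lemma vcat_mult_vec [simp]: "(M \<Zsemi> N) *v z = (M *v z) \<oplus>\<oplus> (N *v z)"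
  by (simp add: vec_eq_iff matrix_vector_mult_def vcat_def block_vec_def split: sum.split)

lemma block_vec_mult_vcat [simp]: "(x \<oplus>\<oplus> y) v* (M \<Zsemi> N) = x v* M + y v* N"
  by (simp add: vec_eq_iff vector_matrix_mult_def vcat_def block_vec_def sum_UNIV_Plus)

lemma mat_mult_vec: "mat c *v x = c *\<^sub>R (x :: real^'n)"
  by (simp add: vec_eq_iff matrix_vector_mult_def mat_def if_distrib if_distribR cong: if_cong)

lemma scaleR_matrix_mult_vec: "(c *\<^sub>R M) *v x = c *\<^sub>R (M *v (x :: real^'n))"
  by (simp add: vec_eq_iff matrix_vector_mult_def sum_distrib_left mult.assoc)

lemma uminus_matrix_mult_vec: "(- M) *v x = - (M *v (x :: real^'n))"
  by (simp add: vec_eq_iff matrix_vector_mult_def sum_negf)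

lemma vec_mult_uminus_matrix: "x v* (- M) = - ((x :: real^'n) v* M)"
  by (simp add: vec_eq_iff vector_matrix_mult_def sum_negf)

lemma inner_vec_mult_matrix: "y \<bullet> (x v* M) = (M *v y) \<bullet> (x :: real^'n)"
  by (metis dot_lmul_matrix inner_commute)

lemma gram_quadratic_form:
  fixes D :: "real^'m^'n"
  shows "v \<bullet> ((D ** transpose D) *v v) = (norm (v v* D))\<^sup>2"
  by (simp add: matrix_vector_mul_assoc [symmetric] dot_lmul_matrix [symmetric] power2_norm_eq_inner)

lemma symmetric_matrix_inner:
  "transpose M = M \<Longrightarrow> x \<bullet> (M *v y) = y \<bullet> (M *v (x :: real^'n))"
  by (metis dot_lmul_matrix inner_commute transpose_matrix_vector)

lemma pos_def_mult_matrix_inv: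
  assumes "pos_def Q"
  shows "Q *v (matrix_inv Q *v x) = x"
proof -
  have "\<forall>v. Q *v v = 0 \<longrightarrow> v = 0"
    using assms by (metis inner_zero_right less_irrefl pos_def_def)
  then have "invertible Q"
    using invertible_left_inverse matrix_left_invertible_ker by blast
  then have "Q ** matrix_inv Q = mat 1"
    unfolding invertible_def matrix_inv_def by (metis (mono_tags, lifting) someI_ex)
  then show ?thesis
    by (simp add: matrix_vector_mul_assoc)
qed

lemma pos_def_matrix_inv_nonneg:
  assumes "pos_def Q"
  shows "0 \<le> x \<bullet> (matrix_inv Q *v x)"
proof -
  let ?e = "matrix_inv Q *v x"
  have "0 \<le> ?e \<bullet> (Q *v ?e)"
    using assms by (cases "?e = 0") (auto simp: pos_def_def less_imp_le)
  then show ?thesis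
    by (simp add: pos_def_mult_matrix_inv [OF assms] inner_commute)
qed

section \<open>Consequences of the matrix inequalities\<close>

text \<open>The Schur complement is obtained by testing with \<open>(1, - Q\<^sup>-\<^sup>1 x)\<close>, the minimizer of the quadratic
  form among the vectors with first block 1.\<close>

lemma lmi_ellipsoid_imp:
  fixes x :: "real^'p"
  assumes Q: "pos_def Q" and lmi: "pos_semidef (lmi_ellipsoid s x Q)"
  shows "x \<bullet> (matrix_inv Q *v x) \<le> s"
proof -
  let ?e = "matrix_inv Q *v x"
  have col: "columnvector x *v (1 :: real^1) = x" and row: "(rowvector x :: real^'p^1) *v y = (x \<bullet> y) *\<^sub>R 1" for y
    by (simp_all add: vec_eq_iff matrix_vector_mult_def columnvector_def rowvector_def inner_vec_def)
  have one: "(1 :: real^1) \<bullet> 1 = 1"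
    by (simp add: inner_vec_def)
  have "0 \<le> ((1 :: real^1) \<oplus>\<oplus> (- ?e)) \<bullet> (lmi_ellipsoid s x Q *v (1 \<oplus>\<oplus> (- ?e)))"
    using lmi by (simp add: pos_semidef_def)
  also have "\<dots> = s - x \<bullet> ?e"
    by (simp add: lmi_ellipsoid_def mat_mult_vec col row one algebra_simps inner_commute
        pos_def_mult_matrix_inv [OF Q] linear_neg [OF matrix_vector_mul_linear])
  finally show ?thesis by simp
qed

text \<open>Testing with \<open>(s e\<^sub>m, - Q\<^sup>-\<^sup>1 x)\<close> gives a quadratic polynomial in the real number \<open>s\<close> that is
  nonnegative everywhere; the bound on the output is the sign of its discriminant.\<close>

lemma lmi_output_imp:
  fixes x :: "real^'p" and C2 :: "real^'p^'q2" and D2 :: "real^'q^'q2"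
  assumes Q: "pos_def Q" and lmi: "pos_semidef (lmi_output C2 D2 sigma_s Lam Q L)"
    and Lam: "Lam $ m $ m \<le> c\<^sup>2" and c: "0 \<le> c" and sigma_s: "0 < sigma_s"
    and x: "x \<bullet> (matrix_inv Q *v x) \<le> sigma_s"
  shows "\<bar>(C2 *v x + D2 *v ((L ** matrix_inv Q) *v x)) $ m\<bar> \<le> c"
proof -
  let ?e = "matrix_inv Q *v x"
  define y where "y = (C2 *v x + D2 *v ((L ** matrix_inv Q) *v x)) $ m"
  have e: "(C2 ** Q + D2 ** L) *v ?e = C2 *v x + D2 *v ((L ** matrix_inv Q) *v x)"
    by (simp add: algebra_simps matrix_vector_mul_assoc [symmetric] pos_def_mult_matrix_inv [OF Q])
  have quadratic: "0 \<le> s\<^sup>2 * c\<^sup>2 / sigma_s - 2 * s * y + sigma_s" for s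
  proof -
    let ?a = "axis m s :: real^'q2"
    have Lam_m: "?a \<bullet> (Lam *v ?a) = s\<^sup>2 * Lam $ m $ m"
      by (simp add: inner_axis' matrix_vector_mul_component inner_axis power2_eq_square)
    have "0 \<le> (?a \<oplus>\<oplus> (- ?e)) \<bullet> (lmi_output C2 D2 sigma_s Lam Q L *v (?a \<oplus>\<oplus> (- ?e)))"
      using lmi by (simp add: pos_semidef_def)
    also have "\<dots> = s\<^sup>2 * Lam $ m $ m / sigma_s - 2 * (?a \<bullet> ((C2 ** Q + D2 ** L) *v ?e)) + x \<bullet> ?e"
      by (simp add: lmi_output_def scaleR_matrix_mult_vec Lam_m inner_diff_right inner_add_right
          inner_vec_mult_matrix inner_commute
          pos_def_mult_matrix_inv [OF Q] linear_neg [OF matrix_vector_mul_linear]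
          del: matrix_vector_mult_add_rdistrib)
    also have "\<dots> = s\<^sup>2 * Lam $ m $ m / sigma_s - 2 * s * y + x \<bullet> ?e"
      by (simp add: e y_def inner_axis')
    also have "\<dots> \<le> s\<^sup>2 * c\<^sup>2 / sigma_s - 2 * s * y + sigma_s"
    proof -
      have "s\<^sup>2 * Lam $ m $ m / sigma_s \<le> s\<^sup>2 * c\<^sup>2 / sigma_s"
        using Lam sigma_s by (intro divide_right_mono mult_left_mono) auto
      then show ?thesis
        using x by linarith
    qed
    finally show ?thesis .
  qed
  have "\<bar>y\<bar> \<le> c"
  proof (cases "c = 0")
    case True
    have "y = 0"
    proof (rule ccontr)
      assume "y \<noteq> 0"
      \<comment> \<open>With \<open>c = 0\<close> the polynomial is affine in \<open>s\<close> with slope \<open>- 2 y\<close>.\<close>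
      then show False
        using quadratic [of "sigma_s / y"] True sigma_s by simp
    qed
    then show ?thesis using c by simp
  next
    case False
    \<comment> \<open>The value of the polynomial at its minimum.\<close>
    have "0 \<le> sigma_s * (c\<^sup>2 - y\<^sup>2) / c\<^sup>2"
      using quadratic [of "sigma_s * y / c\<^sup>2"] False sigma_s
      by (simp add: field_simps power2_eq_square)
    then have "y\<^sup>2 \<le> c\<^sup>2"
      using False sigma_s by (simp add: zero_le_divide_iff zero_le_mult_iff)
    then show ?thesis
      using c by (simp add: abs_le_square_iff [symmetric])
  qed
  then show ?thesis by (simp add: y_def)
qed

text \<open>Completing squares shows how the blocks interact: the last block \<open>g\<close> can cancel \<open>CL *v e\<close>, and
  the entries with \<open>E1\<close> reassemble the norm of the performance output. The vector \<open>b\<close> enters only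
  linearly, apart from the data term.\<close>

lemma lmi_data_quadratic_form:
  fixes a b :: "real^'p" and c :: "real^'q" and d f :: "real^'l" and e :: "real^'p" and g :: "real^'q1"
  assumes Q: "transpose Q = Q"
    and v: "v = a \<oplus>\<oplus> b \<oplus>\<oplus> c \<oplus>\<oplus> d \<oplus>\<oplus> e \<oplus>\<oplus> f \<oplus>\<oplus> g" and CL: "CL = C1 ** Q + D1 ** L"
  shows "v \<bullet> (lmi_data C1 D1 E1 D lam bet g2 Q L *v v) =
    a \<bullet> (Q *v a) - bet * (norm a)\<^sup>2 + 2 * (b \<bullet> (Q *v e)) + 2 * (c \<bullet> (L *v e)) + 2 * (d \<bullet> f)
    + e \<bullet> (Q *v e) + g2 * (norm f)\<^sup>2 + (norm (CL *v e + g))\<^sup>2 - (norm (CL *v e + E1 *v f))\<^sup>2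
    + lam * (norm (v v* D))\<^sup>2"
proof -
  \<comment> \<open>Subtracting the data term leaves the explicit block matrix.\<close>
  have "v \<bullet> ((lmi_data C1 D1 E1 D lam bet g2 Q L - lam *\<^sub>R (D ** transpose D)) *v v) =
    a \<bullet> (Q *v a) - bet * (norm a)\<^sup>2 + 2 * (b \<bullet> (Q *v e)) + 2 * (c \<bullet> (L *v e)) + 2 * (d \<bullet> f)
    + e \<bullet> (Q *v e) + g2 * (norm f)\<^sup>2 + (norm (CL *v e + g))\<^sup>2 - (norm (CL *v e + E1 *v f))\<^sup>2"
    unfolding lmi_data_def Let_def CL [symmetric] v Q
    by (simp add: mat_mult_vec uminus_matrix_mult_vec matrix_vector_mul_assoc [symmetric]
        matrix_vector_mult_diff_rdistrib inner_add_left inner_add_right inner_diff_left inner_diff_right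
        inner_vec_mult_matrix symmetric_matrix_inner [OF Q, of e b] power2_norm_eq_inner
        inner_commute [of "CL *v e" g] inner_commute [of "CL *v e" "E1 *v f"]
        inner_commute [of f d] inner_commute [of "L *v e" c])
  then show ?thesis
    by (simp add: algebra_simps scaleR_matrix_mult_vec gram_quadratic_form)
qed

text \<open>The hypothesis on \<open>k\<close> pays for the perturbation \<open>- x / k\<close> of the second block. The resulting
  term \<open>(norm x)\<^sup>2 / k\<close> is a decrease of the storage function even when the performance output
  vanishes. The sign of \<open>bet\<close> matters because the inequality controls \<open>Q - bet I\<close>, whereas the
  storage function at the next state is measured with \<open>Q\<close> itself.\<close>

lemma lmi_data_dissipation:
  fixes A :: "real^'p^'p" and B :: "real^'q^'p" and E :: "real^'l^'p"
    and C1 :: "real^'p^'q1" and D1 :: "real^'q^'q1" and E1 :: "real^'l^'q1"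
    and Xplus Xminus :: "real^'T^'p" and U :: "real^'T^'q" and W :: "real^'T^'l"
    and x :: "real^'p" and w :: "real^'l"
  assumes data: "Xplus = A ** Xminus + B ** U + E ** W"
    and Q: "pos_def Q" and bet: "0 \<le> bet"
    and lmi: "pos_semidef (lmi_data C1 D1 E1 (data_matrix Xplus Xminus U W) lam bet g2 Q L)"
    and k: "0 < k" "lam * (norm (x v* Xminus))\<^sup>2 \<le> k * (norm x)\<^sup>2"
    and u: "u = (L ** matrix_inv Q) *v x"
    and x': "x' = A *v x + B *v u + E *v w" and y: "y = C1 *v x + D1 *v u + E1 *v w"
  shows "(norm y)\<^sup>2 - g2 * (norm w)\<^sup>2 + (norm x)\<^sup>2 / k
    \<le> x \<bullet> (matrix_inv Q *v x) - x' \<bullet> (matrix_inv Q *v x')"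
proof -
  let ?D = "data_matrix Xplus Xminus U W :: real^'T^('p, 'q, 'l, 'q1) blocks"
  define e where "e = matrix_inv Q *v x"
  define a where "a = - (matrix_inv Q *v x')"
  define g where "g = - ((C1 ** Q + D1 ** L) *v e)"
  define v where "v = a \<oplus>\<oplus> (a v* A - (1 / k) *\<^sub>R x) \<oplus>\<oplus> (a v* B) \<oplus>\<oplus> (a v* E) \<oplus>\<oplus> e \<oplus>\<oplus> w \<oplus>\<oplus> g"
  have Qe: "Q *v e = x" and Qa: "Q *v a = - x'"
    by (simp_all add: e_def a_def pos_def_mult_matrix_inv [OF Q] linear_neg [OF matrix_vector_mul_linear])
  have Le: "L *v e = u"
    by (simp add: e_def u matrix_vector_mul_assoc)
  have CLe: "(C1 ** Q + D1 ** L) *v e + E1 *v w = y"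
    by (simp add: y algebra_simps matrix_vector_mul_assoc [symmetric] Qe Le)
  \<comment> \<open>The data equation cancels the contributions of \<open>a\<close>; only the perturbation survives.\<close>
  have vD: "v v* ?D = (1 / k) *\<^sub>R (x v* Xminus)"
    by (simp add: v_def data_matrix_def vec_mult_uminus_matrix data algebra_simps
        vector_matrix_mul_assoc scaleR_vector_matrix_assoc)
  have "0 \<le> v \<bullet> (lmi_data C1 D1 E1 ?D lam bet g2 Q L *v v)"
    using lmi by (simp add: pos_semidef_def)
  also have "\<dots> = a \<bullet> (- x') - bet * (norm a)\<^sup>2 + 2 * ((a v* A - (1 / k) *\<^sub>R x) \<bullet> x)
      + 2 * ((a v* B) \<bullet> u) + 2 * ((a v* E) \<bullet> w) + e \<bullet> x + g2 * (norm w)\<^sup>2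
      - (norm y)\<^sup>2 + lam * (norm (x v* Xminus))\<^sup>2 / k\<^sup>2"
    using Q k(1) by (subst lmi_data_quadratic_form [OF _ v_def refl])
      (auto simp: pos_def_def Qe Qa Le CLe vD g_def power_divide)
  \<comment> \<open>The three cross terms with \<open>a\<close> recombine into the next state.\<close>
  also have "\<dots> = a \<bullet> x' - bet * (norm a)\<^sup>2 - 2 * (norm x)\<^sup>2 / k + e \<bullet> x + g2 * (norm w)\<^sup>2
      - (norm y)\<^sup>2 + lam * (norm (x v* Xminus))\<^sup>2 / k\<^sup>2"
    by (simp add: inner_diff_left inner_diff_right dot_lmul_matrix x' inner_add_right power2_norm_eq_inner)
  also have "\<dots> \<le> a \<bullet> x' - 2 * (norm x)\<^sup>2 / k + e \<bullet> x + g2 * (norm w)\<^sup>2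
      - (norm y)\<^sup>2 + k * (norm x)\<^sup>2 / k\<^sup>2"
    using k(2) mult_nonneg_nonneg [OF bet, of "(norm a)\<^sup>2"] divide_right_mono [OF k(2), of "k\<^sup>2"] by simp
  also have "\<dots> = a \<bullet> x' - (norm x)\<^sup>2 / k + e \<bullet> x + g2 * (norm w)\<^sup>2 - (norm y)\<^sup>2"
    using k(1) by (simp add: power2_eq_square)
  finally show ?thesis
    by (simp add: a_def e_def inner_commute)
qed

section \<open>Storage functions that change with time\<close>

text \<open>The increments of the dissipation level record exactly the jumps of the storage function when
  \<open>P (t - 1)\<close> is exchanged for \<open>P t\<close> at the state \<open>x t\<close>, so the sum still telescopes.\<close>

lemma sum_supply_le_dissip_level:
  fixes x :: "nat \<Rightarrow> real^'p"
  assumes "\<And>i. s i \<le> x i \<bullet> (P i *v x i) - x (Suc i) \<bullet> (P i *v x (Suc i))" and "t0 \<le> t"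
  shows "(\<Sum>i=t0..t. s i) \<le> x t0 \<bullet> (P t0 *v x t0) - x (Suc t) \<bullet> (P t *v x (Suc t))
    + dissip_level x P t - dissip_level x P t0"
  using assms(2)
proof (induction t rule: nat_induct_at_least)
  case base
  then show ?case using assms(1) [of t0] by simp
next
  case (Suc t)
  then show ?case using assms(1) [of "Suc t"] by simp
qed

lemma tendsto_zero_of_square_summable:
  fixes x :: "nat \<Rightarrow> 'a::real_normed_vector"
  assumes "summable (\<lambda>t. (norm (x t))\<^sup>2)"
  shows "x \<longlonglongrightarrow> 0"
proof -
  have "(\<lambda>t. sqrt ((norm (x t))\<^sup>2)) \<longlonglongrightarrow> sqrt 0"
    by (intro tendsto_real_sqrt summable_LIMSEQ_zero assms)
  then show ?thesis
    by (simp add: tendsto_norm_zero_iff)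
qed

lemma convergent_running_Max:
  fixes f :: "nat \<Rightarrow> real"
  assumes "\<And>t. f t \<le> B"
  shows "convergent (\<lambda>t. Max (f ` {..t}))" and "f i \<le> lim (\<lambda>t. Max (f ` {..t}))"
proof -
  let ?m = "\<lambda>t. Max (f ` {..t})"
  have inc: "incseq ?m"
    by (auto intro!: incseq_SucI Max_mono)
  have "\<forall>t. ?m t \<le> B"
    using assms by (auto simp: Max_le_iff)
  then show conv: "convergent ?m"
    using incseq_convergent [OF inc] by (metis convergentI)
  have "f i \<le> ?m i"
    by (intro Max_ge) auto
  also have "\<dots> \<le> lim ?m"
    using inc conv by (meson convergent_LIMSEQ_iff incseq_le)
  finally show "f i \<le> lim ?m" .
qed

theorem theorem2:
  fixes A :: "real^'p^'p" and B :: "real^'q^'p" and E :: "real^'l^'p"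
    and C1 :: "real^'p^'q1" and D1 :: "real^'q^'q1" and E1 :: "real^'l^'q1"
    and C2 :: "real^'p^'q2" and D2 :: "real^'q^'q2"
    and ymax :: "real^'q2" and sigma_s r1 r2 alpha :: real and alpha_s :: "nat \<Rightarrow> real"
    and Lam :: "real^'q2^'q2" and eta :: "nat \<Rightarrow> real"
    and xd :: "nat \<Rightarrow> real^'p" and ud :: "nat \<Rightarrow> real^'q" and wd :: "nat \<Rightarrow> real^'l"
    and Xplus Xminus :: "real^('T::{finite,linorder})^'p"
    and U :: "real^('T::{finite,linorder})^'q" and W :: "real^('T::{finite,linorder})^'l"
    and x :: "nat \<Rightarrow> real^'p" and u :: "nat \<Rightarrow> real^'q" and w :: "nat \<Rightarrow> real^'l"
    and y1 :: "nat \<Rightarrow> real^'q1" and y2 :: "nat \<Rightarrow> real^'q2"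
    and sigma lam bet gam :: "nat \<Rightarrow> real"
    and Q P :: "nat \<Rightarrow> real^'p^'p" and L K :: "nat \<Rightarrow> real^'p^'q" and p :: "nat \<Rightarrow> real"
  assumes stab: "stabilizable A B" and obs: "observable C1 A"
    and ymax: "\<forall>m. 0 \<le> ymax $ m" and sigma_s: "sigma_s > 0"
    and Lam: "transpose Lam = Lam" and eta: "\<forall>t. 0 \<le> eta t"
    and state: "\<forall>t. x (Suc t) = A *v x t + B *v u t + E *v w t"
    and output1: "\<forall>t. y1 t = C1 *v x t + D1 *v u t + E1 *v w t"
    and output2: "\<forall>t. y2 t = C2 *v x t + D2 *v u t"
    and P: "\<forall>t. P t = matrix_inv (Q t)" and K: "\<forall>t. K t = L t ** matrix_inv (Q t)"
    and feedback: "\<forall>t. u t = K t *v x t"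
    and p: "p = dissip_level x P"
    and disturbance: "alpha \<ge> 0" and "\<forall>t. alpha_s t \<ge> 0"
    and "(\<Sum>t<CARD('T). (norm (wd t))\<^sup>2) \<le> alpha"
    and "\<forall>t<CARD('T). (norm (wd t))\<^sup>2 \<le> alpha_s t"
    and "summable (\<lambda>t. (norm (w t))\<^sup>2)" and "(\<Sum>t. (norm (w t))\<^sup>2) \<le> alpha"
    and samples: "Xplus = samples (\<lambda>t. xd (Suc t))" and "Xminus = samples xd"
    and "U = samples ud" and "W = samples wd"
    and admissible: "Xplus = A ** Xminus + B ** U + E ** W"
    and gam: "\<forall>t. 0 \<le> gam t"
    and optimal: "\<forall>t. is_arg_min (mpc_cost r1 r2)
          (mpc_constraints C1 D1 E1 C2 D2 ymax sigma_s Lam (data_matrix Xplus Xminus U W) (eta t) x P t)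
          (sigma t, lam t, bet t, (gam t)\<^sup>2, Q t, L t)"
    and bounded: "bounded (range (\<lambda>t. (lam t, bet t, sigma t, gam t, Q t, L t)))"
  shows
    "(\<forall>t. sigma t \<le> sigma_s \<longrightarrow> (\<forall>m. \<bar>y2 t $ m\<bar> \<le> ymax $ m))
    \<and> (summable (\<lambda>t. (norm (w t))\<^sup>2) \<longrightarrow> x \<longlonglongrightarrow> 0)
    \<and> convergent (\<lambda>t. Max (gam ` {..t}))
    \<and> (x 0 = 0 \<and> summable (\<lambda>t. (norm (w t))\<^sup>2) \<longrightarrow>
         summable (\<lambda>i. (norm (y1 i))\<^sup>2) \<and>
         (\<Sum>i. (norm (y1 i))\<^sup>2) \<le> (lim (\<lambda>t. Max (gam ` {..t})))\<^sup>2 * (\<Sum>i. (norm (w i))\<^sup>2))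
    \<and> (\<exists>gamma. \<forall>t0 t. t0 \<le> t \<longrightarrow>
         (\<Sum>i=t0..t. (norm (y1 i))\<^sup>2 - gamma\<^sup>2 * (norm (w i))\<^sup>2)
           \<le> x t0 \<bullet> (P t0 *v x t0) + p 0 - p t0 \<and> 0 \<le> p 0 - p t0)"
proof -
  define V where "V i z = z \<bullet> (P i *v z)" for i and z :: "real^'p"
  define s where "s i = (norm (y1 i))\<^sup>2 - (gam i)\<^sup>2 * (norm (w i))\<^sup>2" for i
  have feasible: "mpc_constraints C1 D1 E1 C2 D2 ymax sigma_s Lam (data_matrix Xplus Xminus U W)
      (eta t) x P t (sigma t, lam t, bet t, (gam t)\<^sup>2, Q t, L t)" for t
    using optimal by (simp add: is_arg_min_def)
  have Q: "pos_def (Q t)" and bet: "0 \<le> bet t"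
    and lmi: "pos_semidef (lmi_data C1 D1 E1 (data_matrix Xplus Xminus U W)
      (lam t) (bet t) ((gam t)\<^sup>2) (Q t) (L t))"
    and out: "pos_semidef (lmi_output C2 D2 sigma_s Lam (Q t) (L t))"
    and Lam_diag: "Lam $ m $ m \<le> (ymax $ m)\<^sup>2"
    and ellipsoid: "pos_semidef (lmi_ellipsoid (sigma t) (x t) (Q t))"
    and level: "0 < t \<Longrightarrow> pos_semidef (lmi_ellipsoid
      (x t \<bullet> (P (t - 1) *v x t) + dissip_level x P 0 - dissip_level x P (t - 1)) (x t) (Q t))" for t m
    using feasible [of t] by (auto simp: mpc_constraints_def)
  have u: "u t = (L t ** matrix_inv (Q t)) *v x t" for t
    using feedback K by simp

  have constraint: "\<bar>y2 t $ m\<bar> \<le> ymax $ m" if "sigma t \<le> sigma_s" for t m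
    using lmi_output_imp [OF Q out Lam_diag, where x = "x t"] lmi_ellipsoid_imp [OF Q ellipsoid, of t]
      that ymax sigma_s output2 u by fastforce

  have V_nonneg: "0 \<le> V i z" for i z
    using pos_def_matrix_inv_nonneg [OF Q] P by (simp add: V_def)
  \<comment> \<open>This is what the dissipation constraint is for.\<close>
  have p_le: "p t \<le> p 0" for t
  proof (cases t)
    case (Suc r)
    then show ?thesis
      using lmi_ellipsoid_imp [OF Q level, of t] P by (simp add: p)
  qed simp

  obtain M where M: "norm (lam t, bet t, sigma t, gam t, Q t, L t) \<le> M" for t
    using bounded by (auto simp: bounded_iff)
  have lam_le: "\<bar>lam t\<bar> \<le> M" for t
    using order_trans [OF norm_fst_le M [of t]] by simp
  have gam_le: "gam t \<le> M" for t
  proof -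
    have "norm (gam t, Q t, L t) \<le> M"
      using order_trans [OF norm_snd_le order_trans [OF norm_snd_le order_trans [OF norm_snd_le M [of t]]]] .
    from order_trans [OF norm_fst_le this] show ?thesis by simp
  qed
  note conv = convergent_running_Max [of gam, OF gam_le]
  define ginf where "ginf = lim (\<lambda>t. Max (gam ` {..t}))"
  have gam_sq: "(gam i)\<^sup>2 \<le> ginf\<^sup>2" for i
    using conv(2) [of i] gam by (simp add: ginf_def power_mono)

  define N where "N = onorm ((*v) (transpose Xminus))"
  have N: "norm (z v* Xminus) \<le> N * norm z" for z
    using onorm [OF matrix_vector_mul_bounded_linear, of "transpose Xminus" z] by (simp add: N_def)
  \<comment> \<open>One constant for all times; adding 1 makes it positive.\<close>
  define k where "k = M * N\<^sup>2 + 1"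
  have M_nonneg: "0 \<le> M"
    using lam_le [of 0] by simp
  then have k_pos: "0 < k"
    by (simp add: k_def add_nonneg_pos)
  have k: "lam t * (norm (z v* Xminus))\<^sup>2 \<le> k * (norm z)\<^sup>2" for t z
  proof -
    have "lam t * (norm (z v* Xminus))\<^sup>2 \<le> M * (N * norm z)\<^sup>2"
      using N [of z] lam_le [of t] M_nonneg by (intro mult_mono power_mono) auto
    also have "\<dots> \<le> k * (norm z)\<^sup>2"
      by (simp add: k_def algebra_simps power_mult_distrib)
    finally show ?thesis .
  qed
  have decrease: "s i + (norm (x i))\<^sup>2 / k \<le> V i (x i) - V i (x (Suc i))" for i
    using lmi_data_dissipation [OF admissible Q bet lmi k_pos k u]
      state output1 P unfolding V_def s_def by presburger
  have balance: "s i \<le> V i (x i) - V i (x (Suc i))" for i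
    using decrease [of i] k_pos by (smt (verit) zero_le_divide_iff zero_le_power2)

  \<comment> \<open>Stated for any supply \<open>r\<close>, as it is used with and without the state term.\<close>
  have attenuation: "(\<Sum>i=t0..t. r i) \<le> V t0 (x t0) + p 0 - p t0"
    if "t0 \<le> t" "\<And>i. r i \<le> V i (x i) - V i (x (Suc i))" for r t0 t
    using sum_supply_le_dissip_level [of r x P, OF _ that(1)] that(2) p_le [of t] V_nonneg [of t "x (Suc t)"]
    unfolding V_def p by fastforce

  have w_summable: "summable (\<lambda>t. (norm (w t))\<^sup>2)" by fact
  define Sw where "Sw = (\<Sum>t. (norm (w t))\<^sup>2)"
  have w_sum: "(\<Sum>i\<le>t. (gam i)\<^sup>2 * (norm (w i))\<^sup>2) \<le> ginf\<^sup>2 * Sw" for t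
  proof -
    have "(\<Sum>i\<le>t. (gam i)\<^sup>2 * (norm (w i))\<^sup>2) \<le> (\<Sum>i\<le>t. ginf\<^sup>2 * (norm (w i))\<^sup>2)"
      by (intro sum_mono mult_right_mono gam_sq) auto
    also have "\<dots> \<le> ginf\<^sup>2 * Sw"
      unfolding sum_distrib_left [symmetric] Sw_def
      by (intro mult_left_mono sum_le_suminf w_summable) auto
    finally show ?thesis .
  qed
  have energy: "(\<Sum>i\<le>t. (norm (y1 i))\<^sup>2 + (norm (x i))\<^sup>2 / k) \<le> V 0 (x 0) + ginf\<^sup>2 * Sw" for t
    using attenuation [of 0 t "\<lambda>i. s i + (norm (x i))\<^sup>2 / k", OF _ decrease] w_sum [of t]
    by (simp add: s_def sum.distrib sum_subtractf atMost_atLeast0)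

  have stable: "x \<longlonglongrightarrow> 0"
  proof -
    have "(\<Sum>i\<le>t. (norm (x i))\<^sup>2 / k) \<le> V 0 (x 0) + ginf\<^sup>2 * Sw" for t
      using energy [of t] sum_nonneg [of "{..t}" "\<lambda>i. (norm (y1 i))\<^sup>2"] by (simp add: sum.distrib)
    then have "summable (\<lambda>i. (norm (x i))\<^sup>2 / k)"
      using k_pos by (intro bounded_imp_summable) auto
    then have "summable (\<lambda>i. (norm (x i))\<^sup>2)"
      using k_pos by (simp add: summable_divide_iff)
    then show ?thesis
      by (rule tendsto_zero_of_square_summable)
  qed

  have hinf: "summable (\<lambda>i. (norm (y1 i))\<^sup>2) \<and> (\<Sum>i. (norm (y1 i))\<^sup>2) \<le> ginf\<^sup>2 * Sw" if "x 0 = 0"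
  proof -
    have le: "(\<Sum>i\<le>t. (norm (y1 i))\<^sup>2) \<le> ginf\<^sup>2 * Sw" for t
      using energy [of t] sum_nonneg [of "{..t}" "\<lambda>i. (norm (x i))\<^sup>2 / k"] k_pos that
      by (simp add: sum.distrib V_def)
    then have summable: "summable (\<lambda>i. (norm (y1 i))\<^sup>2)"
      by (intro bounded_imp_summable) auto
    have "(\<Sum>i<t. (norm (y1 i))\<^sup>2) \<le> ginf\<^sup>2 * Sw" for t
      using le [of t] sum_mono2 [of "{..t}" "{..<t}" "\<lambda>i. (norm (y1 i))\<^sup>2"] by fastforce
    then show ?thesis
      using summable by (auto intro: suminf_le_const)
  qed

  have "(\<Sum>i=t0..t. (norm (y1 i))\<^sup>2 - ginf\<^sup>2 * (norm (w i))\<^sup>2)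
      \<le> x t0 \<bullet> (P t0 *v x t0) + p 0 - p t0 \<and> 0 \<le> p 0 - p t0" if "t0 \<le> t" for t0 t
  proof -
    have "(\<Sum>i=t0..t. (norm (y1 i))\<^sup>2 - ginf\<^sup>2 * (norm (w i))\<^sup>2) \<le> (\<Sum>i=t0..t. s i)"
      unfolding s_def by (intro sum_mono diff_mono mult_right_mono gam_sq) auto
    then show ?thesis
      using attenuation [of t0 t s, OF that balance] p_le [of t0] by (simp add: V_def)
  qed
  then show ?thesis
    using constraint stable conv(1) hinf unfolding ginf_def Sw_def by blast
qed

end
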